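(* For all integers $n \geq 9$, \[rd_o(n) > rd_e(n).\]
   Context: An integer partition is a weakly decreasing finite sequence $\mu = (\mu_1, \ldots, \mu_m)$ of positive integers (its parts); $\ell(\mu) := m$ is its length. The perimeter of a nonempty partition $\mu$ is $P(\mu) := \mu_1 + \ell(\mu) - 1$. $rd_o(n)$ is the number of partitions with perimeter $n$ into distinct parts that have more odd parts than even parts, and $rd_e(n)$ is the number of partitions with perimeter $n$ into distinct parts that have more even parts than odd parts. *)

theory Defs
  imports Main
begin

definition is_partition :: "nat list \<Rightarrow> bool" where
  "is_partition \<mu> \<longleftrightarrow> sorted_wrt (\<ge>) \<mu> \<and> (\<forall>p \<in> set \<mu>. p > 0)"

text \<open>Only meaningful for nonempty partitions, where the subtraction does not truncate.\<close>

definition perimeter :: "nat list \<Rightarrow> nat" where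
  "perimeter \<mu> = hd \<mu> + length \<mu> - 1"

definition odd_parts :: "nat list \<Rightarrow> nat" where
  "odd_parts \<mu> = length (filter odd \<mu>)"

definition even_parts :: "nat list \<Rightarrow> nat" where
  "even_parts \<mu> = length (filter even \<mu>)"

definition distinct_partitions :: "nat \<Rightarrow> nat list set" where
  "distinct_partitions n =
     {\<mu>. is_partition \<mu> \<and> \<mu> \<noteq> [] \<and> distinct \<mu> \<and> perimeter \<mu> = n}"

text \<open>The cardinalities below are genuine counts because the sets are finite.\<close>

lemma finite_distinct_partitions: "finite (distinct_partitions n)"
proof (rule finite_subset)
  show "distinct_partitions n \<subseteq> {\<mu>. set \<mu> \<subseteq> {..n} \<and> length \<mu> \<le> n}"
  proof
    fix \<mu> assume \<mu>: "\<mu> \<in> distinct_partitions n"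
    then obtain x xs where eq: "\<mu> = x # xs"
      by (cases \<mu>) (auto simp: distinct_partitions_def)
    with \<mu> have "\<forall>y \<in> set xs. y \<le> x" "x > 0" "x + length xs = n"
      by (auto simp: distinct_partitions_def is_partition_def perimeter_def)
    with eq show "\<mu> \<in> {\<mu>. set \<mu> \<subseteq> {..n} \<and> length \<mu> \<le> n}"
      by fastforce
  qed
  show "finite {\<mu>. set \<mu> \<subseteq> {..n} \<and> length \<mu> \<le> n}"
    by (rule finite_lists_length_le) simp
qed

definition rd_o :: "nat \<Rightarrow> nat" where
  "rd_o n = card {\<mu> \<in> distinct_partitions n. odd_parts \<mu> > even_parts \<mu>}"

definition rd_e :: "nat \<Rightarrow> nat" where
  "rd_e n = card {\<mu> \<in> distinct_partitions n. even_parts \<mu> > odd_parts \<mu>}"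

end

theory Submission
  imports Defs
begin

text \<open>Cut the indicator word of a set of distinct parts into the blocks \<open>{1, 2}\<close>, \<open>{3, 4}\<close>, \dots.
  A block adds 2 plus the number of its parts to the perimeter, and exchanging the two singleton
  blocks negates the excess of odd over even parts. So everything cancels in
  \<open>rd_o n - rd_e n\<close> except the effect of the block of the largest part, which leaves
  \<open>c (n - 1) - c (n - 2)\<close>, where \<open>c w\<close> counts the block words of weight \<open>w\<close> and excess 0 or 1.
  The parity of the excess is that of the weight, and the block recurrence shows that
  \<open>c\<close> increases strictly from weight 7 on.\<close>

section \<open>Block words by weight and excess\<close>

fun block_words :: "nat \<Rightarrow> int \<Rightarrow> nat" where
  "block_words 0 d = of_bool (d = 0)"
| "block_words (Suc 0) d = 0"
| "block_words (Suc (Suc 0)) d = of_bool (d = 0)"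
| "block_words (Suc (Suc (Suc 0))) d = of_bool (\<bar>d\<bar> = 1)"
| "block_words (Suc (Suc (Suc (Suc w)))) d =
     block_words (Suc (Suc w)) d + block_words w d
     + block_words (Suc w) (d - 1) + block_words (Suc w) (d + 1)"

lemma block_words_uminus: "block_words w (- d) = block_words w d"
proof (induction w d rule: block_words.induct)
  case (5 w d)
  have "- d - 1 = - (d + 1)" "- d + 1 = - (d - 1)" by simp_all
  with 5 show ?case by (simp only: block_words.simps)
qed simp_all

text \<open>A block weighs at least the absolute value of its excess. This removes the far ends of
  the telescoped sums in \<open>rd_diff\<close>.\<close>

lemma block_words_eq_0: "int w < \<bar>d\<bar> \<Longrightarrow> block_words w d = 0"
  by (induction w d rule: block_words.induct) auto

text \<open>Each block has weight and excess (2, 0), (3, 1), (3, -1) or (4, 0), always of equal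
  parity.\<close>

lemma block_words_parity: "odd (int w + d) \<Longrightarrow> block_words w d = 0"
proof (induction w d rule: block_words.induct)
  case (4 d)
  then show ?case by (auto simp: abs_if split: if_splits)
qed auto

text \<open>Adding an empty block, of weight 2 and excess 0, is injective on words.\<close>

lemma block_words_mono: "block_words w d \<le> block_words (Suc (Suc w)) d"
  by (induction w d rule: block_words.induct) (auto simp: abs_if)

text \<open>The recurrence reduces the claim at \<open>d\<close> to those at \<open>d - 1\<close>,
  \<open>d\<close> and \<open>d + 1\<close>, so the induction must reach down to
  \<open>d = -1\<close>, where symmetry gives equality.\<close>

lemma block_words_unimodal: "-1 \<le> d \<Longrightarrow> block_words w (d + 2) \<le> block_words w d"
proof (induction w d rule: block_words.induct)
  case (5 w d)
  show ?case
  proof (cases "d = -1")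
    case True
    then show ?thesis by (simp add: block_words_uminus del: block_words.simps)
  next
    case False
    with 5 have "block_words (Suc w) (d - 1 + 2) \<le> block_words (Suc w) (d - 1)"
      "block_words (Suc w) (d + 1 + 2) \<le> block_words (Suc w) (d + 1)"
      "block_words (Suc (Suc w)) (d + 2) \<le> block_words (Suc (Suc w)) d"
      "block_words w (d + 2) \<le> block_words w d"
      by simp_all
    moreover have "d - 1 + 2 = d + 2 - 1" "d + 1 + 2 = d + 2 + 1" by simp_all
    ultimately show ?thesis by (simp only: block_words.simps)
  qed
qed (auto simp: abs_if)

section \<open>Strict growth of the balanced counts\<close>

text \<open>By parity at most one summand is nonzero; the sum is what telescoping over the excess
  leaves, for either parity of the weight.\<close>

definition balanced_words :: "nat \<Rightarrow> nat" where
  "balanced_words w = block_words w 0 + block_words w 1"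

lemma balanced_words_even: "even w \<Longrightarrow> balanced_words w = block_words w 0"
  by (simp add: balanced_words_def block_words_parity)

lemma balanced_words_odd: "odd w \<Longrightarrow> balanced_words w = block_words w 1"
  by (simp add: balanced_words_def block_words_parity)

lemma block_words_0_pos: "even w \<Longrightarrow> 0 < block_words w 0"
  by (induction w "0::int" rule: block_words.induct) auto

lemma balanced_words_less_odd:
  assumes "odd w"
  shows "balanced_words w < balanced_words (Suc w)"
proof (cases "w < 5")
  case True
  with assms have "w = 1 \<or> w = 3" by presburger
  then show ?thesis by (auto simp: balanced_words_def numeral_eq_Suc)
next
  case False
  define v where "v = w - 5"
  have w: "w = Suc (Suc (Suc (Suc (Suc v))))" and v: "even v"
    using False assms by (auto simp: v_def)
  \<comment> \<open>Expanding both sides once, and the leading term of the larger side once more,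
    leaves a surplus of at least \<open>block_words v 0\<close>.\<close>
  have "block_words (Suc (Suc (Suc (Suc v)))) 0 =
      block_words (Suc (Suc v)) 0 + block_words v 0 + 2 * block_words (Suc v) 1"
    using block_words_uminus[of "Suc v" 1] by simp
  moreover have "block_words (Suc (Suc v)) 2 \<le> block_words (Suc (Suc v)) 0"
    using block_words_unimodal[of 0 "Suc (Suc v)"] by simp
  moreover have "block_words (Suc v) 1 \<le> block_words (Suc (Suc (Suc v))) 1"
    by (rule block_words_mono)
  moreover have "block_words (Suc w) 0 = block_words (Suc (Suc (Suc (Suc v)))) 0
      + block_words (Suc (Suc v)) 0 + 2 * block_words (Suc (Suc (Suc v))) 1"
    using block_words_uminus[of "Suc (Suc (Suc v))" 1] by (simp only: w block_words.simps) simp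
  moreover have "block_words w 1 = block_words (Suc (Suc (Suc v))) 1
      + block_words (Suc v) 1 + block_words (Suc (Suc v)) 0 + block_words (Suc (Suc v)) 2"
    by (simp only: w block_words.simps) simp
  moreover have "0 < block_words v 0" using v by (rule block_words_0_pos)
  ultimately have "block_words w 1 < block_words (Suc w) 0"
    by linarith
  with assms show ?thesis by (simp add: balanced_words_even balanced_words_odd)
qed

text \<open>With \<open>a\<close>, \<open>b\<close>, \<open>e\<close> the values at excess 0, 1, 2, two applications of the recurrence give
  \<open>b\<^sub>m - a\<^sub>m = (b\<^sub>m\<^sub>-\<^sub>1 - a\<^sub>m\<^sub>-\<^sub>1) + (b\<^sub>m\<^sub>-\<^sub>3 - b\<^sub>m\<^sub>-\<^sub>4) + (e\<^sub>m\<^sub>-\<^sub>1 - e\<^sub>m\<^sub>-\<^sub>3)\<close>,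
  where \<open>a\<^sub>m\<close>, \<open>e\<^sub>m\<close> have weight \<open>2 m\<close> and \<open>b\<^sub>m\<close> has weight \<open>2 m + 1\<close>; the last two differences
  are nonnegative.\<close>

lemma block_words_gap_mono:
  "block_words (v + 7) 1 + block_words (v + 8) 0 \<le> block_words (v + 9) 1 + block_words (v + 6) 0"
proof -
  have u: "block_words k (-1) = block_words k 1" for k
    by (rule block_words_uminus)
  have r0: "block_words (k + 4) 0 = block_words (k + 2) 0 + block_words k 0
      + 2 * block_words (k + 1) 1" for k
    using u[of "Suc k"] by (simp add: numeral_eq_Suc)
  have r1: "block_words (k + 4) 1 = block_words (k + 2) 1 + block_words k 1
      + block_words (k + 1) 0 + block_words (k + 1) 2" for k
    by (simp add: numeral_eq_Suc)
  have m: "block_words k d \<le> block_words (k + 2) d" for k d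
    using block_words_mono[of k d] by simp
  note arith = add.assoc numeral_plus_numeral numeral_plus_one one_plus_numeral
    add_num_simps one_add_one
  show ?thesis
    using r0[of "v + 4", unfolded arith] r0[of "v + 2", unfolded arith]
      r1[of "v + 5", unfolded arith] r1[of "v + 1", unfolded arith]
      m[of "v + 1" 1, unfolded arith] m[of "v + 2" 2, unfolded arith]
      m[of "v + 4" 2, unfolded arith]
    by linarith
qed

text \<open>The gap never shrinks as the weight grows by 2, so one strict case suffices: weights 8
  and 9 give 11 and 13. Weights 6 and 7 both give 5, hence the start at 8.\<close>

lemma balanced_words_less_even:
  assumes "even w" "8 \<le> w"
  shows "balanced_words w < balanced_words (Suc w)"
proof -
  have "block_words (2 * m + 8) 0 < block_words (2 * m + 9) 1" for m
  proof (induction m)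
    case 0
    show ?case by (simp add: numeral_eq_Suc)
  next
    case (Suc m)
    have "block_words (2 * m + 9) 1 + block_words (2 * Suc m + 8) 0
        \<le> block_words (2 * Suc m + 9) 1 + block_words (2 * m + 8) 0"
      using block_words_gap_mono[of "2 * m + 2"] by (simp add: ac_simps)
    with Suc.IH show ?case by linarith
  qed
  from this[of "(w - 8) div 2"] assms show ?thesis
    by (simp add: balanced_words_even balanced_words_odd)
qed

section \<open>Partitions sorted by excess\<close>

definition excess :: "nat list \<Rightarrow> int" where
  "excess \<mu> = int (odd_parts \<mu>) - int (even_parts \<mu>)"

definition excess_partitions :: "nat \<Rightarrow> int \<Rightarrow> nat list set" where
  "excess_partitions n d = {\<mu> \<in> distinct_partitions n. excess \<mu> = d}"

lemma finite_excess_partitions: "finite (excess_partitions n d)"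
  by (simp add: excess_partitions_def finite_distinct_partitions)

text \<open>Merges weak decrease and distinctness into strict decrease and removes the truncated
  subtraction from the perimeter.\<close>

lemma excess_partitions_iff:
  "\<mu> \<in> excess_partitions n d \<longleftrightarrow> sorted_wrt (>) \<mu> \<and> 0 \<notin> set \<mu> \<and> \<mu> \<noteq> []
     \<and> hd \<mu> + length \<mu> = Suc n \<and> excess \<mu> = d"
proof -
  have "sorted_wrt (\<ge>) \<mu> \<and> distinct \<mu> \<longleftrightarrow> sorted_wrt (>) \<mu>"
    by (induction \<mu>) (auto simp: order.strict_iff_order)
  moreover have "\<mu> \<noteq> [] \<Longrightarrow> hd \<mu> + length \<mu> - 1 = n \<longleftrightarrow> hd \<mu> + length \<mu> = Suc n"
    by (cases \<mu>) auto
  ultimately show ?thesis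
    by (auto simp: excess_partitions_def distinct_partitions_def is_partition_def perimeter_def
        intro: gr0I)
qed

lemma excess_simps [simp]:
  "excess [] = 0"
  "excess (x # \<mu>) = (if odd x then 1 else -1) + excess \<mu>"
  "excess (\<mu> @ \<nu>) = excess \<mu> + excess \<nu>"
  "excess (map (\<lambda>x. Suc (Suc x)) \<mu>) = excess \<mu>"
  by (auto simp: excess_def odd_parts_def even_parts_def filter_map o_def)

section \<open>Splitting off the lowest block\<close>

text \<open>Shifting by 2 moves every block up by one and keeps parities. As parts are listed in
  decreasing order, the new lowest block \<open>t\<close> goes to the end.\<close>

definition prepend_block :: "nat list \<Rightarrow> nat list \<Rightarrow> nat list" where
  "prepend_block t \<nu> = map (\<lambda>x. Suc (Suc x)) \<nu> @ t"

lemma inj_prepend_block: "inj (prepend_block t)"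
  by (auto simp: inj_def prepend_block_def inj_map_eq_map)

text \<open>Shifted parts are at least 3, so \<open>t\<close> can be read off; this makes the images
  for different \<open>t\<close> disjoint.\<close>

lemma prepend_block_tail: "0 \<notin> set \<nu> \<Longrightarrow> set t \<subseteq> {1, 2} \<Longrightarrow>
    filter (\<lambda>x. x \<le> 2) (prepend_block t \<nu>) = t"
  by (induction \<nu>) (auto simp: prepend_block_def filter_id_conv subset_iff)

lemma prepend_block_exhaust:
  assumes "sorted_wrt (>) \<mu>" "0 \<notin> set \<mu>"
  shows "\<exists>\<nu>. \<exists>t \<in> {[], [1], [2], [2, 1]}.
    \<mu> = prepend_block t \<nu> \<and> sorted_wrt (>) \<nu> \<and> 0 \<notin> set \<nu>"
  using assms
proof (induction \<mu>)
  case Nil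
  then show ?case by (intro exI[of _ "[]"]) (simp add: prepend_block_def)
next
  case (Cons x \<mu>)
  then obtain \<nu> t where t: "t \<in> {[], [1], [2], [2, 1]}"
    and \<mu>: "\<mu> = prepend_block t \<nu>" and \<nu>: "sorted_wrt (>) \<nu>" "0 \<notin> set \<nu>"
    by auto
  show ?case
  proof (cases "x \<le> 2")
    case True
    \<comment> \<open>A part of \<open>\<nu>\<close> would appear in \<open>\<mu>\<close> as a
      number at least 3, yet it must lie below \<open>x\<close>.\<close>
    have "\<nu> = []"
      using True Cons.prems \<mu> \<nu>(2) by (cases \<nu>) (auto simp: prepend_block_def)
    moreover have "x = 1 \<or> x = 2" using True Cons.prems by auto
    ultimately have "x # \<mu> \<in> {[], [1], [2], [2, 1]}"
      using t \<mu> Cons.prems by (auto simp: prepend_block_def)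
    then show ?thesis
      by (intro exI[of _ "[]"] bexI[of _ "x # \<mu>"]) (auto simp: prepend_block_def)
  next
    case False
    have "Suc (Suc y) < x" if "y \<in> set \<nu>" for y
      using Cons.prems \<mu> that by (auto simp: prepend_block_def)
    then have "sorted_wrt (>) ((x - 2) # \<nu>)"
      using \<nu> by (simp add: less_diff_conv)
    moreover have "x # \<mu> = prepend_block t ((x - 2) # \<nu>)"
      using False \<mu> by (simp add: prepend_block_def)
    ultimately show ?thesis
      using False \<nu> t by (intro exI[of _ "(x - 2) # \<nu>"] bexI[of _ t]) auto
  qed
qed

text \<open>The largest part grows by 2 and the length by \<open>length t\<close>. For empty
  \<open>\<nu>\<close> there is no largest part to shift, and the perimeter would change
  differently.\<close>

lemma prepend_block_mem:
  assumes "\<nu> \<noteq> []" "0 \<notin> set \<nu>" "t \<in> {[], [1], [2], [2, 1]}"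
  shows "prepend_block t \<nu> \<in> excess_partitions (n + 2 + length t) (d + excess t)
     \<longleftrightarrow> \<nu> \<in> excess_partitions n d"
  using assms
  by (auto simp: excess_partitions_iff prepend_block_def hd_append hd_map sorted_wrt_append
      sorted_wrt_map) (metis gr0I)+

text \<open>The lowest block is empty, full, \<open>{1}\<close> or \<open>{2}\<close>; these are the
  four summands in the recurrence of \<open>block_words\<close>.\<close>

lemma excess_partitions_rec:
  "excess_partitions (n + 4) d =
     prepend_block [] ` excess_partitions (n + 2) d
     \<union> prepend_block [2, 1] ` excess_partitions n d
     \<union> prepend_block [1] ` excess_partitions (n + 1) (d - 1)
     \<union> prepend_block [2] ` excess_partitions (n + 1) (d + 1)" (is "?L = ?R")
proof
  have mem: "\<nu> \<noteq> [] \<and> 0 \<notin> set \<nu>" if "\<nu> \<in> excess_partitions k c" for \<nu> k c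
    using that by (simp add: excess_partitions_iff)
  show "?R \<subseteq> ?L"
    using mem prepend_block_mem[of _ "[]" "n + 2" d] prepend_block_mem[of _ "[2, 1]" n d]
      prepend_block_mem[of _ "[1]" "n + 1" "d - 1"] prepend_block_mem[of _ "[2]" "n + 1" "d + 1"]
    by (auto simp: numeral_eq_Suc)
  show "?L \<subseteq> ?R"
  proof
    fix \<mu> assume \<mu>: "\<mu> \<in> ?L"
    then obtain \<nu> t where t: "t \<in> {[], [1], [2], [2, 1]}" "\<mu> = prepend_block t \<nu>"
      and \<nu>: "0 \<notin> set \<nu>"
      using prepend_block_exhaust[of \<mu>] by (auto simp: excess_partitions_iff)
    \<comment> \<open>Otherwise \<open>\<mu> = t\<close>, whose perimeter is at most 3.\<close>
    have "\<nu> \<noteq> []"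
      using \<mu> t by (auto simp: excess_partitions_iff prepend_block_def)
    with \<mu> t \<nu> show "\<mu> \<in> ?R"
      using prepend_block_mem[of \<nu> "[]" "n + 2" d] prepend_block_mem[of \<nu> "[2, 1]" n d]
        prepend_block_mem[of \<nu> "[1]" "n + 1" "d - 1"]
        prepend_block_mem[of \<nu> "[2]" "n + 1" "d + 1"]
      by (auto simp: numeral_eq_Suc)
  qed
qed

lemma card_excess_partitions_rec:
  "card (excess_partitions (n + 4) d) =
     card (excess_partitions (n + 2) d) + card (excess_partitions n d)
     + card (excess_partitions (n + 1) (d - 1)) + card (excess_partitions (n + 1) (d + 1))"
proof -
  have tail: "filter (\<lambda>x. x \<le> 2) \<mu> = t"
    if "\<mu> \<in> prepend_block t ` excess_partitions k c" "set t \<subseteq> {1, 2}" for \<mu> t k c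
    using that prepend_block_tail[of _ t] by (auto simp: excess_partitions_iff)
  have disj: "prepend_block t ` excess_partitions k c \<inter> prepend_block t' ` excess_partitions k' c' = {}"
    if t: "t \<noteq> t'" "set t \<subseteq> {1, 2}" "set t' \<subseteq> {1, 2}" for t t' k k' c c'
  proof (rule equals0I)
    fix \<mu> assume "\<mu> \<in> prepend_block t ` excess_partitions k c
      \<inter> prepend_block t' ` excess_partitions k' c'"
    with t(2,3) have "filter (\<lambda>x. x \<le> 2) \<mu> = t" "filter (\<lambda>x. x \<le> 2) \<mu> = t'"
      using tail[of \<mu> t k c] tail[of \<mu> t' k' c'] by simp_all
    with t(1) show False by simp
  qed
  have card: "card (prepend_block t ` excess_partitions k c) = card (excess_partitions k c)" for t k c
    by (rule card_image, rule inj_on_subset[OF inj_prepend_block]) simp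
  show ?thesis
    unfolding excess_partitions_rec
    by (simp add: card_Un_disjoint finite_excess_partitions Int_Un_distrib2 disj card)
qed

section \<open>Partition counts in terms of block words\<close>

lemma excess_partitions_0: "excess_partitions 0 d = {}"
  by (auto simp: excess_partitions_iff neq_Nil_conv)

lemma excess_partitionsE:
  assumes "\<mu> \<in> excess_partitions n d"
  obtains x xs where "\<mu> = x # xs" "x + length xs = n" "0 < x" "\<forall>y \<in> set xs. 0 < y \<and> y < x"
proof (cases \<mu>)
  case (Cons x xs)
  with assms show ?thesis
    by (intro that[of x xs]) (auto simp: excess_partitions_iff intro: gr0I)
qed (use assms in \<open>simp add: excess_partitions_iff\<close>)

lemma excess_partitions_1: "excess_partitions 1 d = (if d = 1 then {[1]} else {})"
proof -
  have "\<mu> = [1]" if "\<mu> \<in> excess_partitions 1 d" for \<mu>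
    using that
  proof (rule excess_partitionsE)
    fix x xs
    assume "\<mu> = x # xs" "x + length xs = 1" "0 < x"
    then show ?thesis by (cases xs) auto
  qed
  moreover have "[1] \<in> excess_partitions 1 d \<longleftrightarrow> d = 1"
    by (auto simp: excess_partitions_iff)
  ultimately show ?thesis by auto
qed

lemma excess_partitions_2: "excess_partitions 2 d = (if d = -1 then {[2]} else {})"
proof -
  have "\<mu> = [2]" if "\<mu> \<in> excess_partitions 2 d" for \<mu>
    using that
  proof (rule excess_partitionsE)
    fix x xs
    assume "\<mu> = x # xs" "x + length xs = 2" "0 < x" "\<forall>y \<in> set xs. 0 < y \<and> y < x"
    then show ?thesis by (cases xs) auto
  qed
  moreover have "[2] \<in> excess_partitions 2 d \<longleftrightarrow> d = -1"
    by (auto simp: excess_partitions_iff)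
  ultimately show ?thesis by auto
qed

lemma excess_partitions_3:
  "excess_partitions 3 d = (if d = 1 then {[3]} else if d = 0 then {[2, 1]} else {})"
proof -
  have "\<mu> = [3] \<or> \<mu> = [2, 1]" if "\<mu> \<in> excess_partitions 3 d" for \<mu>
    using that
  proof (rule excess_partitionsE)
    fix x xs
    assume "\<mu> = x # xs" "x + length xs = 3" "0 < x" "\<forall>y \<in> set xs. 0 < y \<and> y < x"
    then show ?thesis by (cases xs; cases "tl xs") auto
  qed
  moreover have "[3] \<in> excess_partitions 3 d \<longleftrightarrow> d = 1" "[2, 1] \<in> excess_partitions 3 d \<longleftrightarrow> d = 0"
    by (auto simp: excess_partitions_iff)
  ultimately show ?thesis by auto
qed

lemma block_words_rec:
  "block_words (n + 4) d =
     block_words (n + 2) d + block_words n d + block_words (n + 1) (d - 1) + block_words (n + 1) (d + 1)"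
  by (simp add: numeral_eq_Suc)

lemma block_words_small:
  "block_words 1 d = 0"
  "block_words 2 d = of_bool (d = 0)"
  "block_words 3 d = of_bool (\<bar>d\<bar> = 1)"
  by (simp_all add: numeral_eq_Suc)

text \<open>The block of the largest part holds only its odd number, only its even number, or both.
  This adds 1, 2 or 3 to the weight of the word below it, and 1, -1 or 0 to the excess.\<close>

lemma card_excess_partitions:
  "card (excess_partitions (n + 3) d) =
     block_words (n + 2) (d - 1) + block_words (n + 1) (d + 1) + block_words n d"
proof (induction n arbitrary: d rule: less_induct)
  case (less n)
  note small = excess_partitions_0 excess_partitions_1 excess_partitions_2 excess_partitions_3
    block_words_small
  note arith = add.assoc numeral_plus_numeral numeral_plus_one one_plus_numeral
    add_num_simps one_add_one diff_add_cancel add_diff_cancel_right'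
  \<comment> \<open>Both sides obey the same recurrence, but \<open>block_words n d\<close> does so
    only from \<open>n = 4\<close> on.\<close>
  consider "n = 0" | "n = 1" | "n = 2" | "n = 3" | "n \<ge> 4" by linarith
  then show ?case
  proof cases
    case 1
    then show ?thesis by (auto simp: small)
  next
    case 2
    show ?thesis
      unfolding 2 arith card_excess_partitions_rec[of 0 d, unfolded add_0_left]
      by (auto simp: small simp del: One_nat_def)
  next
    case 3
    show ?thesis
      unfolding 3 arith card_excess_partitions_rec[of 1 d, unfolded arith]
        block_words_rec[of 0, unfolded add_0_left]
      by (auto simp: small simp del: One_nat_def)
  next
    case 4
    show ?thesis
      unfolding 4 arith card_excess_partitions_rec[of 2 d, unfolded arith]
        card_excess_partitions_rec[of 0 d, unfolded add_0_left]
        block_words_rec[of 0, unfolded add_0_left] block_words_rec[of 1, unfolded arith]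
      by (auto simp: small simp del: One_nat_def)
  next
    case 5
    then obtain m where n: "n = m + 4" by (metis add.commute le_Suc_ex)
    note IH = less.IH[of "m + 2" d] less.IH[of m d] less.IH[of "m + 1" "d - 1"]
      less.IH[of "m + 1" "d + 1"]
    have "m + 2 < n" "m < n" "m + 1 < n" by (simp_all add: n)
    then show ?thesis
      using IH card_excess_partitions_rec[of "m + 3" d] block_words_rec[of "m + 2" "d - 1"]
        block_words_rec[of "m + 1" "d + 1"] block_words_rec[of m d]
      unfolding n arith by linarith
  qed
qed

section \<open>The difference of the two counts\<close>

lemma abs_excess_le: "\<mu> \<in> distinct_partitions n \<Longrightarrow> \<bar>excess \<mu>\<bar> \<le> int n"
proof -
  assume "\<mu> \<in> distinct_partitions n"
  then have "\<mu> \<in> excess_partitions n (excess \<mu>)"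
    by (simp add: excess_partitions_def)
  then have "length \<mu> \<le> n"
    by (cases \<mu>) (auto simp: excess_partitions_iff intro: gr0I)
  moreover have "\<bar>excess \<mu>\<bar> \<le> int (length \<mu>)"
    by (induction \<mu>) auto
  ultimately show ?thesis by simp
qed

text \<open>The sign \<open>s\<close> treats both majorities at once: 1 for odd parts, -1 for even
  parts.\<close>

lemma card_distinct_partitions_pos:
  fixes s :: int
  assumes "\<bar>s\<bar> = 1"
  shows "card {\<mu> \<in> distinct_partitions n. 0 < s * excess \<mu>} =
    (\<Sum>d = 1..n. card (excess_partitions n (s * int d)))"
proof -
  have s: "s = 1 \<or> s = -1" using assms by linarith
  have "{\<mu> \<in> distinct_partitions n. 0 < s * excess \<mu>} =
      (\<Union>d \<in> {1..n}. excess_partitions n (s * int d))"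
  proof safe
    fix \<mu> assume \<mu>: "\<mu> \<in> distinct_partitions n" "0 < s * excess \<mu>"
    show "\<mu> \<in> (\<Union>d \<in> {1..n}. excess_partitions n (s * int d))"
      using \<mu> s abs_excess_le[OF \<mu>(1)]
      by (intro UN_I[of "nat (s * excess \<mu>)"]) (auto simp: excess_partitions_def)
  qed (use s in \<open>auto simp: excess_partitions_def\<close>)
  moreover have "card \<dots> = (\<Sum>d = 1..n. card (excess_partitions n (s * int d)))"
    by (rule card_UN_disjoint) (use s in \<open>auto simp: finite_distinct_partitions excess_partitions_def\<close>)
  ultimately show ?thesis by simp
qed

lemma sum_telescope_two:
  fixes f :: "int \<Rightarrow> 'a :: ab_group_add"
  shows "(\<Sum>d = 1..n. f (int d - 1) - f (int d + 1)) = f 0 + f 1 - f (int n) - f (int n + 1)"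
  by (induction n) (simp_all add: algebra_simps)

lemma rd_diff:
  "int (rd_o (n + 3)) - int (rd_e (n + 3)) =
     int (balanced_words (n + 2)) - int (balanced_words (n + 1))"
proof -
  define f where "f k d = int (block_words k d)" for k d
  have f_minus: "f k (- d) = f k d" for k d
    by (simp add: f_def block_words_uminus)
  have f_0: "f k d = 0" if "int k < \<bar>d\<bar>" for k d
    using that by (simp add: f_def block_words_eq_0)
  have "int (rd_o (n + 3)) - int (rd_e (n + 3)) =
      (\<Sum>d = 1..n + 3. int (card (excess_partitions (n + 3) (int d)))
        - int (card (excess_partitions (n + 3) (- int d))))"
    using card_distinct_partitions_pos[of 1 "n + 3"] card_distinct_partitions_pos[of "-1" "n + 3"]
    by (simp add: rd_o_def rd_e_def excess_def sum_subtractf)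
  also have "\<dots> = (\<Sum>d = 1..n + 3. (f (n + 2) (int d - 1) - f (n + 2) (int d + 1))
      - (f (n + 1) (int d - 1) - f (n + 1) (int d + 1)))"
  proof (rule sum.cong)
    fix d
    \<comment> \<open>Symmetry turns the terms at \<open>- int d\<close> into terms at positive
      excess; the summand of weight \<open>n\<close>, from a full top block, cancels.\<close>
    have "f (n + 2) (- int d - 1) = f (n + 2) (int d + 1)"
      "f (n + 1) (- int d + 1) = f (n + 1) (int d - 1)"
      using f_minus[of _ "int d + 1"] f_minus[of _ "int d - 1"] by simp_all
    then show "int (card (excess_partitions (n + 3) (int d)))
        - int (card (excess_partitions (n + 3) (- int d))) =
      (f (n + 2) (int d - 1) - f (n + 2) (int d + 1))
      - (f (n + 1) (int d - 1) - f (n + 1) (int d + 1))"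
      using f_minus[of n "int d"] unfolding card_excess_partitions f_def by simp
  qed simp
  also have "\<dots> = (\<Sum>d = 1..n + 3. f (n + 2) (int d - 1) - f (n + 2) (int d + 1))
      - (\<Sum>d = 1..n + 3. f (n + 1) (int d - 1) - f (n + 1) (int d + 1))"
    by (rule sum_subtractf)
  \<comment> \<open>The upper end terms have excess at least \<open>n + 3\<close>, above both
    weights, and vanish.\<close>
  also have "\<dots> = (f (n + 2) 0 + f (n + 2) 1) - (f (n + 1) 0 + f (n + 1) 1)"
    unfolding sum_telescope_two by (simp add: f_0)
  finally show ?thesis by (simp add: f_def balanced_words_def)
qed

theorem mainTheorem2:
  fixes n :: nat
  assumes "n \<ge> 9"
  shows "rd_o n > rd_e n"
proof -
  define k where "k = n - 3"
  with assms have n: "n = k + 3" and k: "6 \<le> k" by simp_all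
  \<comment> \<open>For \<open>k = 6\<close> the weight 7 is odd; every larger \<open>k\<close>
    gives weight at least 8, where both parities are covered.\<close>
  have "balanced_words (k + 1) < balanced_words (k + 2)"
    using k balanced_words_less_odd[of "k + 1"] balanced_words_less_even[of "k + 1"]
    by (cases "k = 6") auto
  then show ?thesis using rd_diff[of k] n by simp
qed

end
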